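(* Let $\sigma,h>0$ and let $D\in\mathbb{R}^{d\times d}$ be a diagonal matrix with positive trace and diagonal entries in increasing order. Let $\{B_i\}_{1\le i\le k}$ be a fixed partition of the standard basis $\{e_1,\dots,e_d\}$ of $\mathbb{R}^d$ into $k$ cells, where the cell $B_i$ with $n_i$ elements is represented by the $d\times n_i$ matrix whose columns are its elements, and let $B=[B_1\ B_2\ \cdots\ B_k]\in\mathbb{R}^{d\times d}$. Let $S_B\in\mathbb{R}^{d\times d}$ be block-diagonal with $i$-th block $S_{B_i}\in\mathbb{R}^{n_i\times n_i}$ (giving the coordinates of the difference vectors in the space spanned by $B_i$). Then $$l_{D,\sigma,h}(BS_B)=\sum_{i=1}^k l_{D_{B_i},\sigma,h}(S_{B_i}),\qquad D_{B_i}=B_i^TDB_i.$$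
   Context: For any dimension $n$, symmetric $H\in\mathbb{R}^{n\times n}$ and $\sigma,h>0$, the function $l_{H,\sigma,h}:\mathbb{R}^{n\times n}\to[0,\infty]$ is $$l_{H,\sigma,h}(S)=\frac14\left\|S^{-T}[s_1^THs_1,\dots,s_n^THs_n]^T\right\|_2^2+\sigma^2\|S^{-1}\|_F^2+\sigma^2\|S^{-T}\mathbf{1}\|_2^2$$ if $S$ is invertible and $\|S\|_2\le h$ (spectral norm), and $l_{H,\sigma,h}(S)=\infty$ otherwise. Here $s_i$ is the $i$-th column of $S$ (a "difference vector"), $S^{-T}=(S^T)^{-1}$, $\mathbf{1}\in\mathbb{R}^n$ is the all-ones vector, and $\|\cdot\|_F$ is the Frobenius norm. *)

theory Defs
  imports
    "Jordan_Normal_Form.Gauss_Jordan_Elimination"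
    "HOL-Library.Extended_Nonnegative_Real"
    "HOL-Library.Disjoint_Sets"
begin

definition mat_trace :: "real mat \<Rightarrow> real" where
  "mat_trace A = sum_list (diag_mat A)"

definition vec_norm2 :: "real vec \<Rightarrow> real" where
  "vec_norm2 v = sqrt (v \<bullet> v)"

definition frobenius_norm :: "real mat \<Rightarrow> real" where
  "frobenius_norm A = sqrt (\<Sum>i<dim_row A. \<Sum>j<dim_col A. (A $$ (i, j))\<^sup>2)"

text \<open>
  The spectral norm is the operator norm induced by the Euclidean norm. Taking the supremum
  over the closed unit ball instead of the sphere keeps the set nonempty when there are no columns.
\<close>

definition spectral_norm :: "real mat \<Rightarrow> real" where
  "spectral_norm A =
     (SUP v \<in> {v \<in> carrier_vec (dim_col A). vec_norm2 v \<le> 1}. vec_norm2 (A *\<^sub>v v))"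

text \<open>
  The inverses below are meaningful only for an invertible argument; \<open>mse_bound\<close> uses them only
  in that case.
\<close>

definition inv_mat :: "real mat \<Rightarrow> real mat" where
  "inv_mat A = the (mat_inverse A)"

definition inv_transpose_mat :: "real mat \<Rightarrow> real mat" where
  "inv_transpose_mat A = inv_mat (transpose_mat A)"

text \<open>
  The function \<open>l\<close> with parameters \<open>H\<close>, \<open>\<sigma>\<close>, \<open>h\<close>, for square \<open>H\<close> and \<open>S\<close> of the same dimension.
  The argument of \<^const>\<open>ennreal\<close> is a sum of nonnegative terms, so nothing is truncated.
\<close>

definition mse_bound :: "real mat \<Rightarrow> real \<Rightarrow> real \<Rightarrow> real mat \<Rightarrow> ennreal" where
  "mse_bound H \<sigma> h S =
     (if invertible_mat S \<and> spectral_norm S \<le> h then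
        ennreal
         (1 / 4 * (vec_norm2 (inv_transpose_mat S *\<^sub>v
                     vec (dim_col S) (\<lambda>i. col S i \<bullet> (H *\<^sub>v col S i))))\<^sup>2
          + \<sigma>\<^sup>2 * (frobenius_norm (inv_mat S))\<^sup>2
          + \<sigma>\<^sup>2 * (vec_norm2 (inv_transpose_mat S *\<^sub>v vec (dim_col S) (\<lambda>_. 1)))\<^sup>2)
      else \<infinity>)"

text \<open>Horizontal concatenation of matrices that all have \<open>d\<close> rows.\<close>

definition concat_cols :: "nat \<Rightarrow> 'a mat list \<Rightarrow> 'a mat" where
  "concat_cols d As = mat_of_cols d (concat (map cols As))"

end

theory Submission
  imports Defs "Jordan_Normal_Form.Determinant"
begin

text \<open>
  The matrix \<open>P = [B\<^sub>1 \<dots> B\<^sub>k]\<close> has the standard basis vectors as its columns, in some order, so it is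
  orthogonal, and \<open>l\<close> is invariant under a change of orthonormal basis: \<open>l\<close> with \<open>D\<close> at \<open>P S\<close>
  equals \<open>l\<close> with \<open>P\<^sup>T D P\<close> at \<open>S\<close>. As \<open>D\<close> is diagonal, \<open>P\<^sup>T D P\<close> is block diagonal with blocks
  \<open>B\<^sub>i\<^sup>T D B\<^sub>i\<close>. On block diagonal arguments \<open>l\<close> is additive: each of the three squared norms splits,
  and invertibility and the bound on the spectral norm hold iff they hold for every block,
  so that both sides are infinite in the same cases.
\<close>

section \<open>Squared norms as scalar products, and bounds on the spectral norm\<close>

lemma scalar_prod_self_nonneg: "0 \<le> (v :: real vec) \<bullet> v"
  by (simp add: scalar_prod_def sum_nonneg)

lemma vec_norm2_square: "(vec_norm2 v)\<^sup>2 = v \<bullet> v"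
  by (simp add: vec_norm2_def scalar_prod_self_nonneg)

lemma frobenius_norm_square:
  "(frobenius_norm A)\<^sup>2 = (\<Sum>i<dim_row A. row A i \<bullet> row A i)"
proof -
  have "(frobenius_norm A)\<^sup>2 = (\<Sum>i<dim_row A. \<Sum>j<dim_col A. (A $$ (i, j))\<^sup>2)"
    by (simp add: frobenius_norm_def sum_nonneg)
  also have "\<dots> = (\<Sum>i<dim_row A. row A i \<bullet> row A i)"
    by (intro sum.cong) (auto simp: scalar_prod_def power2_eq_square atLeast0LessThan)
  finally show ?thesis .
qed

text \<open>A real supremum is an upper bound only once the set is known to be bounded. On the unit
  ball each coordinate of \<open>v\<close> has absolute value at most 1, so each coordinate of
  \<open>A *\<^sub>v v\<close> is at most an absolute row sum.\<close>

lemma bdd_above_mult_unit_ball: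
  "bdd_above ((\<lambda>v. vec_norm2 (A *\<^sub>v v)) ` {v \<in> carrier_vec (dim_col A). vec_norm2 v \<le> 1})"
proof (rule bdd_aboveI2)
  let ?b = "\<Sum>i<dim_row A. (\<Sum>j<dim_col A. \<bar>A $$ (i, j)\<bar>)\<^sup>2"
  fix v assume v: "v \<in> {v \<in> carrier_vec (dim_col A). vec_norm2 v \<le> 1}"
  have "v \<bullet> v \<le> 1"
    using v by (simp add: vec_norm2_def)
  have entry: "\<bar>v $ j\<bar> \<le> 1" if "j < dim_col A" for j
  proof -
    have "(v $ j)\<^sup>2 \<le> (\<Sum>j<dim_col A. (v $ j)\<^sup>2)"
      using that by (intro member_le_sum) auto
    also have "\<dots> = v \<bullet> v"
      using v by (auto simp: scalar_prod_def power2_eq_square atLeast0LessThan)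
    also note \<open>v \<bullet> v \<le> 1\<close>
    finally show ?thesis
      by (simp add: abs_square_le_1)
  qed
  have "(A *\<^sub>v v) \<bullet> (A *\<^sub>v v) = (\<Sum>i<dim_row A. (\<Sum>j<dim_col A. A $$ (i, j) * v $ j)\<^sup>2)"
    using v by (auto simp: scalar_prod_def power2_eq_square atLeast0LessThan intro!: sum.cong)
  also have "\<dots> \<le> ?b"
  proof (rule sum_mono)
    fix i
    have "\<bar>\<Sum>j<dim_col A. A $$ (i, j) * v $ j\<bar> \<le> (\<Sum>j<dim_col A. \<bar>A $$ (i, j) * v $ j\<bar>)"
      by (rule sum_abs)
    also have "\<dots> \<le> (\<Sum>j<dim_col A. \<bar>A $$ (i, j)\<bar>)"
      using entry by (intro sum_mono) (simp add: abs_mult mult_left_le)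
    finally show "(\<Sum>j<dim_col A. A $$ (i, j) * v $ j)\<^sup>2 \<le> (\<Sum>j<dim_col A. \<bar>A $$ (i, j)\<bar>)\<^sup>2"
      by (auto simp: sum_nonneg simp flip: abs_le_square_iff)
  qed
  finally show "vec_norm2 (A *\<^sub>v v) \<le> sqrt ?b"
    by (simp add: vec_norm2_def)
qed

text \<open>Replaces the supremum by a quadratic inequality without roots, which splits over
  orthogonal sums and is visibly preserved by isometries. One direction normalises \<open>v\<close>,
  the other is the least upper bound property.\<close>

lemma spectral_norm_le_iff:
  assumes A: "A \<in> carrier_mat m n" and h: "0 \<le> h"
  shows "spectral_norm A \<le> h \<longleftrightarrow>
    (\<forall>v\<in>carrier_vec n. (A *\<^sub>v v) \<bullet> (A *\<^sub>v v) \<le> h\<^sup>2 * (v \<bullet> v))" (is "_ \<longleftrightarrow> ?R")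
proof
  let ?U = "{v \<in> carrier_vec (dim_col A). vec_norm2 v \<le> 1}"
  assume le: "spectral_norm A \<le> h"
  show ?R
  proof
    fix v :: "real vec" assume v: "v \<in> carrier_vec n"
    show "(A *\<^sub>v v) \<bullet> (A *\<^sub>v v) \<le> h\<^sup>2 * (v \<bullet> v)"
    \<comment> \<open>A null vector cannot be normalised; for it both sides are zero.\<close>
    proof (cases "v \<bullet> v = 0")
      case True
      then have "v = 0\<^sub>v n"
        using v by (auto simp: scalar_prod_def sum_nonneg_eq_0_iff intro!: eq_vecI)
      then have "A *\<^sub>v v = 0\<^sub>v m"
        using A by auto
      then show ?thesis
        using True by simp
    next
      case False
      then have pos: "0 < v \<bullet> v"
        using scalar_prod_self_nonneg[of v] by simp
      \<comment> \<open>\<open>c\<close> rescales \<open>v\<close> to length 1, and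
        \<open>c2\<close> serves below to undo the scaling.\<close>
      define c where "c = 1 / vec_norm2 v"
      have c2: "c\<^sup>2 * (v \<bullet> v) = 1"
        using pos by (simp add: c_def power_divide vec_norm2_square)
      have "c \<cdot>\<^sub>v v \<in> ?U"
        using v A c2 by (auto simp: vec_norm2_def power2_eq_square mult.assoc)
      then have "vec_norm2 (A *\<^sub>v (c \<cdot>\<^sub>v v)) \<le> spectral_norm A"
        unfolding spectral_norm_def by (rule cSUP_upper[OF _ bdd_above_mult_unit_ball])
      then have "vec_norm2 (A *\<^sub>v (c \<cdot>\<^sub>v v)) \<le> h"
        using le by simp
      then have "(vec_norm2 (A *\<^sub>v (c \<cdot>\<^sub>v v)))\<^sup>2 \<le> h\<^sup>2"
        by (intro power_mono) (simp_all add: vec_norm2_def scalar_prod_self_nonneg)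
      moreover have "A *\<^sub>v (c \<cdot>\<^sub>v v) = c \<cdot>\<^sub>v (A *\<^sub>v v)"
        using A v by (rule mult_mat_vec)
      ultimately have "c\<^sup>2 * ((A *\<^sub>v v) \<bullet> (A *\<^sub>v v)) \<le> h\<^sup>2"
        using A v unfolding vec_norm2_square by (simp add: power2_eq_square mult.assoc)
      then have "(v \<bullet> v) * (c\<^sup>2 * ((A *\<^sub>v v) \<bullet> (A *\<^sub>v v))) \<le> (v \<bullet> v) * h\<^sup>2"
        using pos by (intro mult_left_mono) auto
      moreover have "(v \<bullet> v) * (c\<^sup>2 * ((A *\<^sub>v v) \<bullet> (A *\<^sub>v v))) = (A *\<^sub>v v) \<bullet> (A *\<^sub>v v)"
        by (metis c2 mult.assoc mult.commute mult_1)
      ultimately show ?thesis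
        by (simp add: mult.commute)
    qed
  qed
next
  let ?U = "{v \<in> carrier_vec (dim_col A). vec_norm2 v \<le> 1}"
  assume R: ?R
  show "spectral_norm A \<le> h"
    unfolding spectral_norm_def
  proof (rule cSUP_least)
    have "0\<^sub>v (dim_col A) \<in> ?U"
      by (simp add: vec_norm2_def)
    then show "?U \<noteq> {}"
      by blast
  next
    fix v assume v: "v \<in> ?U"
    then have "(A *\<^sub>v v) \<bullet> (A *\<^sub>v v) \<le> h\<^sup>2 * (v \<bullet> v)"
      using R A by auto
    also have "\<dots> \<le> h\<^sup>2"
      using v by (simp add: vec_norm2_def mult_left_le)
    finally have "sqrt ((A *\<^sub>v v) \<bullet> (A *\<^sub>v v)) \<le> sqrt (h\<^sup>2)"
      by (rule real_sqrt_le_mono)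
    then show "vec_norm2 (A *\<^sub>v v) \<le> h"
      using h by (simp add: vec_norm2_def)
  qed
qed

section \<open>Invertibility and explicit inverses of square matrices\<close>

lemma invertible_mat_iff_right_inverse:
  fixes A :: "'a :: field mat"
  assumes A: "A \<in> carrier_mat n n"
  shows "invertible_mat A \<longleftrightarrow> (\<exists>X\<in>carrier_mat n n. A * X = 1\<^sub>m n)"
proof
  assume "invertible_mat A"
  then obtain X where X: "A * X = 1\<^sub>m n" "X * A = 1\<^sub>m (dim_row X)"
    using A by (auto simp: invertible_mat_def inverts_mat_def)
  \<comment> \<open>\<open>invertible_mat\<close> fixes no size for \<open>X\<close>; counting
    columns in the two equations determines it.\<close>
  have "dim_col X = n"
    using arg_cong[OF X(1), of dim_col] by simp
  moreover have "dim_row X = n"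
    using arg_cong[OF X(2), of dim_col] A by simp
  ultimately show "\<exists>X\<in>carrier_mat n n. A * X = 1\<^sub>m n"
    using X(1) by blast
next
  assume "\<exists>X\<in>carrier_mat n n. A * X = 1\<^sub>m n"
  then obtain X where X: "X \<in> carrier_mat n n" "A * X = 1\<^sub>m n"
    by blast
  then show "invertible_mat A"
    using mat_mult_left_right_inverse[OF A X] A
    by (auto simp: invertible_mat_def inverts_mat_def intro!: exI[of _ X])
qed

text \<open>Multiplicativity of the determinant then settles invertibility of block diagonal
  matrices and of products.\<close>

lemma invertible_mat_iff_det:
  fixes A :: "'a :: field mat"
  assumes A: "A \<in> carrier_mat n n"
  shows "invertible_mat A \<longleftrightarrow> det A \<noteq> 0"
proof
  assume "invertible_mat A"
  then obtain X where X: "X \<in> carrier_mat n n" "A * X = 1\<^sub>m n"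
    using invertible_mat_iff_right_inverse[OF A] by blast
  then have "det A * det X = 1"
    using det_mult[OF A X(1)] by simp
  then show "det A \<noteq> 0"
    by auto
next
  assume "det A \<noteq> 0"
  then have "A \<in> Units (ring_mat TYPE('a) n ())"
    by (rule det_non_zero_imp_unit[OF A])
  then show "invertible_mat A"
    unfolding invertible_mat_iff_right_inverse[OF A] Units_def by (auto simp: ring_mat_def)
qed

text \<open>Any right inverse may stand for the computed one: Gauss-Jordan elimination succeeds on a
  unit of the matrix ring, and inverses are unique.\<close>

lemma inv_mat_eqI:
  assumes A: "A \<in> carrier_mat n n" and X: "X \<in> carrier_mat n n" and AX: "A * X = 1\<^sub>m n"
  shows "inv_mat A = X"
proof -
  have XA: "X * A = 1\<^sub>m n"
    using A X AX by (rule mat_mult_left_right_inverse)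
  have "A \<in> Units (ring_mat TYPE(real) n ())"
    using A X AX XA by (auto simp: Units_def ring_mat_def)
  then have "mat_inverse A \<noteq> None"
    using mat_inverse(1)[OF A, where b = "()"] by blast
  then obtain Y where Y: "mat_inverse A = Some Y"
    by blast
  have AY: "A * Y = 1\<^sub>m n" "Y \<in> carrier_mat n n"
    using mat_inverse(2)[OF A Y] by auto
  have "X = X * (A * Y)"
    using X by (simp add: AY)
  also have "\<dots> = (X * A) * Y"
    using X A AY(2) by (simp add: assoc_mult_mat)
  also have "\<dots> = Y"
    using AY(2) by (simp add: XA)
  finally show ?thesis
    by (simp add: inv_mat_def Y)
qed

section \<open>The finite value of \<open>l\<close> in terms of a given inverse\<close>

text \<open>The diagonal of \<open>S\<^sup>T * H * S\<close>, to which \<open>l\<close> applies the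
  inverse transpose of \<open>S\<close>.\<close>

definition quad_diag :: "real mat \<Rightarrow> real mat \<Rightarrow> real vec" where
  "quad_diag H S = vec (dim_col S) (\<lambda>i. col S i \<bullet> (H *\<^sub>v col S i))"

text \<open>The finite value of \<open>mse_bound\<close>, with the inverse \<open>X\<close> of \<open>S\<close> as an argument.\<close>

definition mse_value :: "real mat \<Rightarrow> real \<Rightarrow> real mat \<Rightarrow> real mat \<Rightarrow> real" where
  "mse_value H \<sigma> S X =
     1 / 4 * ((X\<^sup>T *\<^sub>v quad_diag H S) \<bullet> (X\<^sup>T *\<^sub>v quad_diag H S))
     + \<sigma>\<^sup>2 * (\<Sum>i<dim_row X. row X i \<bullet> row X i)
     + \<sigma>\<^sup>2 * ((X\<^sup>T *\<^sub>v vec (dim_col S) (\<lambda>_. 1)) \<bullet> (X\<^sup>T *\<^sub>v vec (dim_col S) (\<lambda>_. 1)))"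

lemma mse_value_nonneg: "0 \<le> mse_value H \<sigma> S X"
  by (simp add: mse_value_def scalar_prod_self_nonneg sum_nonneg)

text \<open>Exhibiting a right inverse \<open>X\<close> is enough to evaluate \<open>l\<close>: it
  is also a left inverse, so transposing \<open>X * S = 1\<^sub>m n\<close> shows that
  \<open>X\<^sup>T\<close> is the inverse transpose.\<close>

lemma mse_bound_eq_mse_value:
  assumes S: "S \<in> carrier_mat n n" and X: "X \<in> carrier_mat n n" and SX: "S * X = 1\<^sub>m n"
    and le: "spectral_norm S \<le> h"
  shows "mse_bound H \<sigma> h S = ennreal (mse_value H \<sigma> S X)"
proof -
  have "invertible_mat S"
    using invertible_mat_iff_right_inverse[OF S] X SX by blast
  moreover have inv: "inv_mat S = X"
    using S X SX by (rule inv_mat_eqI)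
  moreover have "S\<^sup>T * X\<^sup>T = 1\<^sub>m n"
    using mat_mult_left_right_inverse[OF S X SX] transpose_mult[OF X S] by simp
  then have "inv_transpose_mat S = X\<^sup>T"
    unfolding inv_transpose_mat_def using S X by (intro inv_mat_eqI) auto
  ultimately show ?thesis
    using le by (simp add: mse_bound_def mse_value_def quad_diag_def vec_norm2_square frobenius_norm_square)
qed

lemma mse_bound_eq_top: "\<not> (invertible_mat S \<and> spectral_norm S \<le> h) \<Longrightarrow> mse_bound H \<sigma> h S = \<infinity>"
  by (auto simp: mse_bound_def)


section \<open>Block diagonal matrices with two blocks\<close>

text \<open>One step of the recursion of \<open>diag_block_mat\<close>, isolated so that lists of
  blocks reduce to two blocks by induction.\<close>

definition block_diag :: "'a :: zero mat \<Rightarrow> 'a mat \<Rightarrow> 'a mat" where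
  "block_diag A B =
     four_block_mat A (0\<^sub>m (dim_row A) (dim_col B)) (0\<^sub>m (dim_row B) (dim_col A)) B"

lemma diag_block_mat_Cons: "diag_block_mat (A # As) = block_diag A (diag_block_mat As)"
  by (simp add: block_diag_def Let_def)

lemma block_diag_carrier [simp]:
  "A \<in> carrier_mat n n \<Longrightarrow> B \<in> carrier_mat m m \<Longrightarrow> block_diag A B \<in> carrier_mat (n + m) (n + m)"
  by (simp add: block_diag_def)

context
  fixes A B :: "'a :: field mat" and n m :: nat
  assumes A: "A \<in> carrier_mat n n" and B: "B \<in> carrier_mat m m"
begin

lemma block_diag_mult_append_vec:
  assumes "v \<in> carrier_vec n" "w \<in> carrier_vec m"
  shows "block_diag A B *\<^sub>v (v @\<^sub>v w) = (A *\<^sub>v v) @\<^sub>v (B *\<^sub>v w)"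
  using mult_mat_vec_split[OF A B assms] A B by (simp add: block_diag_def)

lemma col_block_diag:
  "j < n \<Longrightarrow> col (block_diag A B) j = col A j @\<^sub>v 0\<^sub>v m"
  "\<not> j < n \<Longrightarrow> j < n + m \<Longrightarrow> col (block_diag A B) j = 0\<^sub>v n @\<^sub>v col B (j - n)"
  using A B unfolding block_diag_def
  by (auto simp: col_four_block_mat[of A n n _ m _ m B])

lemma row_block_diag:
  "i < n \<Longrightarrow> row (block_diag A B) i = row A i @\<^sub>v 0\<^sub>v m"
  "\<not> i < n \<Longrightarrow> i < n + m \<Longrightarrow> row (block_diag A B) i = 0\<^sub>v n @\<^sub>v row B (i - n)"
  using A B unfolding block_diag_def
  by (auto simp: row_four_block_mat[of A n n _ m _ m B])

lemma transpose_block_diag: "(block_diag A B)\<^sup>T = block_diag A\<^sup>T B\<^sup>T"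
  using A B unfolding block_diag_def
  by (simp add: transpose_four_block_mat[of A n n _ m _ m B])

lemma block_diag_mult:
  assumes "C \<in> carrier_mat n n" "D \<in> carrier_mat m m"
  shows "block_diag A B * block_diag C D = block_diag (A * C) (B * D)"
  using A B assms unfolding block_diag_def
  by (simp add: mult_four_block_mat[of A n n _ m _ m B C n _ m])

text \<open>The determinant is the product of those of the blocks.\<close>

lemma invertible_block_diag_iff:
  "invertible_mat (block_diag A B) \<longleftrightarrow> invertible_mat A \<and> invertible_mat B"
proof -
  have "det (block_diag A B) = det A * det B"
    unfolding block_diag_def using A B by (intro det_four_block_mat_lower_left_zero) auto
  then show ?thesis
    using A B by (simp add: invertible_mat_iff_det[of _ n] invertible_mat_iff_det[of _ m]
        invertible_mat_iff_det[OF block_diag_carrier])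
qed

end

lemma block_diag_one: "block_diag (1\<^sub>m n) (1\<^sub>m m) = 1\<^sub>m (n + m)"
  by (simp add: block_diag_def)

lemma append_vec_cases:
  assumes "v \<in> carrier_vec (n + m)"
  obtains v1 v2 where "v1 \<in> carrier_vec n" "v2 \<in> carrier_vec m" "v = v1 @\<^sub>v v2"
  using vec_first_last_append[OF assms] by (metis vec_first_carrier vec_last_carrier)

text \<open>By Pythagoras both sides of the quadratic inequality split along
  \<open>v @\<^sub>v w\<close>. The inequalities for the blocks add up, and padding with zeros
  recovers each of them.\<close>

lemma spectral_norm_block_diag_le_iff:
  assumes A: "A \<in> carrier_mat n n" and B: "B \<in> carrier_mat m m" and h: "0 \<le> h"
  shows "spectral_norm (block_diag A B) \<le> h \<longleftrightarrow> spectral_norm A \<le> h \<and> spectral_norm B \<le> h"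
    (is "?L \<longleftrightarrow> ?R")
proof -
  note iffs = spectral_norm_le_iff[OF A h] spectral_norm_le_iff[OF B h]
    spectral_norm_le_iff[OF block_diag_carrier[OF A B] h]
  have split: "(block_diag A B *\<^sub>v (v @\<^sub>v w)) \<bullet> (block_diag A B *\<^sub>v (v @\<^sub>v w)) =
      (A *\<^sub>v v) \<bullet> (A *\<^sub>v v) + (B *\<^sub>v w) \<bullet> (B *\<^sub>v w)"
    "(v @\<^sub>v w) \<bullet> (v @\<^sub>v w) = v \<bullet> v + w \<bullet> w"
    if "v \<in> carrier_vec n" "w \<in> carrier_vec m" for v w
    using that A B by (simp_all add: block_diag_mult_append_vec[OF A B] scalar_prod_append[of _ n _ m])
  show ?thesis
  proof
    assume ?L
    then have *: "(A *\<^sub>v v) \<bullet> (A *\<^sub>v v) + (B *\<^sub>v w) \<bullet> (B *\<^sub>v w) \<le> h\<^sup>2 * (v \<bullet> v + w \<bullet> w)"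
      if "v \<in> carrier_vec n" "w \<in> carrier_vec m" for v w
      using iffs(3) that split[OF that] by (metis append_carrier_vec)
    have "(A *\<^sub>v v) \<bullet> (A *\<^sub>v v) \<le> h\<^sup>2 * (v \<bullet> v)" if "v \<in> carrier_vec n" for v
      using *[OF that zero_carrier_vec] scalar_prod_self_nonneg[of "B *\<^sub>v 0\<^sub>v m"] by simp
    moreover have "(B *\<^sub>v w) \<bullet> (B *\<^sub>v w) \<le> h\<^sup>2 * (w \<bullet> w)" if "w \<in> carrier_vec m" for w
      using *[OF zero_carrier_vec that] scalar_prod_self_nonneg[of "A *\<^sub>v 0\<^sub>v n"] by simp
    ultimately show ?R
      unfolding iffs by blast
  next
    assume R: ?R
    show ?L
      unfolding iffs
    proof
      fix u :: "real vec" assume "u \<in> carrier_vec (n + m)"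
      then obtain v w where vw: "v \<in> carrier_vec n" "w \<in> carrier_vec m" and u: "u = v @\<^sub>v w"
        by (rule append_vec_cases)
      have "(A *\<^sub>v v) \<bullet> (A *\<^sub>v v) + (B *\<^sub>v w) \<bullet> (B *\<^sub>v w) \<le> h\<^sup>2 * (v \<bullet> v) + h\<^sup>2 * (w \<bullet> w)"
        using R vw unfolding iffs by (intro add_mono) auto
      then show "(block_diag A B *\<^sub>v u) \<bullet> (block_diag A B *\<^sub>v u) \<le> h\<^sup>2 * (u \<bullet> u)"
        unfolding u split[OF vw] by (simp add: distrib_left)
    qed
  qed
qed

lemma quad_diag_carrier [simp]: "S \<in> carrier_mat m n \<Longrightarrow> quad_diag H S \<in> carrier_vec n"
  by (simp add: quad_diag_def)

text \<open>A column of the block matrix is a column of one block padded with zeros, so only the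
  matching block of \<open>H\<close> contributes.\<close>

lemma quad_diag_block_diag:
  assumes H: "H1 \<in> carrier_mat n n" "H2 \<in> carrier_mat m m"
    and S: "S1 \<in> carrier_mat n n" "S2 \<in> carrier_mat m m"
  shows "quad_diag (block_diag H1 H2) (block_diag S1 S2) = quad_diag H1 S1 @\<^sub>v quad_diag H2 S2"
proof (rule eq_vecI)
  have dim: "dim_col (block_diag S1 S2) = n + m" "dim_col S1 = n" "dim_col S2 = m"
    using S by (auto simp: block_diag_def)
  then show "dim_vec (quad_diag (block_diag H1 H2) (block_diag S1 S2)) =
      dim_vec (quad_diag H1 S1 @\<^sub>v quad_diag H2 S2)"
    by (simp add: quad_diag_def)
  fix i assume "i < dim_vec (quad_diag H1 S1 @\<^sub>v quad_diag H2 S2)"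
  then have i: "i < n + m"
    by (simp add: quad_diag_def dim)
  have cols: "col S1 j \<in> carrier_vec n" "col S2 j \<in> carrier_vec m" for j
    using S by auto
  show "quad_diag (block_diag H1 H2) (block_diag S1 S2) $ i = (quad_diag H1 S1 @\<^sub>v quad_diag H2 S2) $ i"
  proof (cases "i < n")
    case True
    then show ?thesis
      using i H cols by (simp add: quad_diag_def dim col_block_diag(1)[OF S]
          block_diag_mult_append_vec[OF H] scalar_prod_append[of _ n _ m])
  next
    case False
    then show ?thesis
      using i H cols by (simp add: quad_diag_def dim col_block_diag(2)[OF S]
          block_diag_mult_append_vec[OF H] scalar_prod_append[of _ n _ m])
  qed
qed

text \<open>The inverse is block diagonal too, so Pythagoras splits the first and third terms, while
  the Frobenius term splits row by row.\<close>

lemma mse_value_block_diag: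
  assumes H: "H1 \<in> carrier_mat n n" "H2 \<in> carrier_mat m m"
    and S: "S1 \<in> carrier_mat n n" "S2 \<in> carrier_mat m m"
    and X: "X1 \<in> carrier_mat n n" "X2 \<in> carrier_mat m m"
  shows "mse_value (block_diag H1 H2) \<sigma> (block_diag S1 S2) (block_diag X1 X2) =
    mse_value H1 \<sigma> S1 X1 + mse_value H2 \<sigma> S2 X2"
proof -
  have dim: "dim_col (block_diag S1 S2) = n + m" "dim_col S1 = n" "dim_col S2 = m"
      "dim_row (block_diag X1 X2) = n + m" "dim_row X1 = n" "dim_row X2 = m"
    using S X by (auto simp: block_diag_def)
  have XT: "X1\<^sup>T \<in> carrier_mat n n" "X2\<^sup>T \<in> carrier_mat m m"
    using X by auto
  have norm: "((block_diag X1 X2)\<^sup>T *\<^sub>v (v @\<^sub>v w)) \<bullet> ((block_diag X1 X2)\<^sup>T *\<^sub>v (v @\<^sub>v w)) =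
      (X1\<^sup>T *\<^sub>v v) \<bullet> (X1\<^sup>T *\<^sub>v v) + (X2\<^sup>T *\<^sub>v w) \<bullet> (X2\<^sup>T *\<^sub>v w)"
    if "v \<in> carrier_vec n" "w \<in> carrier_vec m" for v w
    unfolding transpose_block_diag[OF X] block_diag_mult_append_vec[OF XT that]
    using that XT by (intro scalar_prod_append[of _ n _ m]) auto
  have ones: "vec (n + m) (\<lambda>_. 1 :: real) = vec n (\<lambda>_. 1) @\<^sub>v vec m (\<lambda>_. 1)"
    by (rule eq_vecI) auto
  have sum_split: "(\<Sum>i<n + m. f i) = (\<Sum>i<n. f i) + (\<Sum>i<m. f (n + i))" for f :: "nat \<Rightarrow> real"
    by (induction m) (simp_all add: add.assoc)
  have "(\<Sum>i<n + m. row (block_diag X1 X2) i \<bullet> row (block_diag X1 X2) i) =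
      (\<Sum>i<n. row (block_diag X1 X2) i \<bullet> row (block_diag X1 X2) i) +
      (\<Sum>i<m. row (block_diag X1 X2) (n + i) \<bullet> row (block_diag X1 X2) (n + i))"
    by (rule sum_split)
  also have "\<dots> = (\<Sum>i<n. row X1 i \<bullet> row X1 i) + (\<Sum>i<m. row X2 i \<bullet> row X2 i)"
  proof -
    have "row X1 i \<in> carrier_vec n" "row X2 i \<in> carrier_vec m" for i
      using X by auto
    then show ?thesis
      by (simp add: row_block_diag[OF X] scalar_prod_append[of _ n _ m])
  qed
  finally have rows: "(\<Sum>i<n + m. row (block_diag X1 X2) i \<bullet> row (block_diag X1 X2) i) =
      (\<Sum>i<n. row X1 i \<bullet> row X1 i) + (\<Sum>i<m. row X2 i \<bullet> row X2 i)" .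
  show ?thesis
    unfolding mse_value_def dim rows ones quad_diag_block_diag[OF H S]
    \<comment> \<open>The two instances are the vector of quadratic forms and the all-ones
      vector.\<close>
    by (subst (1 2) norm) (use S in \<open>simp_all add: algebra_simps\<close>)
qed

text \<open>If both blocks are admissible, the inverses of the blocks form the inverse of the whole.
  Otherwise the whole is inadmissible as well, and an infinite summand absorbs the other.\<close>

lemma mse_bound_block_diag:
  assumes H: "H1 \<in> carrier_mat n n" "H2 \<in> carrier_mat m m"
    and S: "S1 \<in> carrier_mat n n" "S2 \<in> carrier_mat m m" and h: "0 \<le> h"
  shows "mse_bound (block_diag H1 H2) \<sigma> h (block_diag S1 S2) =
    mse_bound H1 \<sigma> h S1 + mse_bound H2 \<sigma> h S2"
proof (cases "(invertible_mat S1 \<and> spectral_norm S1 \<le> h) \<and> (invertible_mat S2 \<and> spectral_norm S2 \<le> h)")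
  case True
  then obtain X1 X2 where X: "X1 \<in> carrier_mat n n" "X2 \<in> carrier_mat m m"
      and SX: "S1 * X1 = 1\<^sub>m n" "S2 * X2 = 1\<^sub>m m"
    using S by (auto simp: invertible_mat_iff_right_inverse)
  have "block_diag S1 S2 * block_diag X1 X2 = 1\<^sub>m (n + m)"
    by (simp add: block_diag_mult[OF S X] SX block_diag_one)
  moreover have "spectral_norm (block_diag S1 S2) \<le> h"
    using True by (simp add: spectral_norm_block_diag_le_iff[OF S h])
  ultimately have "mse_bound (block_diag H1 H2) \<sigma> h (block_diag S1 S2) =
      ennreal (mse_value (block_diag H1 H2) \<sigma> (block_diag S1 S2) (block_diag X1 X2))"
    using S X by (intro mse_bound_eq_mse_value[of _ "n + m"]) auto
  also have "\<dots> = ennreal (mse_value H1 \<sigma> S1 X1) + ennreal (mse_value H2 \<sigma> S2 X2)"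
    \<comment> \<open>\<open>ennreal\<close> truncates negative numbers, so additivity needs the
      nonnegativity of both values.\<close>
    by (simp add: mse_value_block_diag[OF H S X] mse_value_nonneg)
  also have "\<dots> = mse_bound H1 \<sigma> h S1 + mse_bound H2 \<sigma> h S2"
    using True S X SX by (simp add: mse_bound_eq_mse_value[of _ n] mse_bound_eq_mse_value[of _ m])
  finally show ?thesis .
next
  case False
  then have "\<not> (invertible_mat (block_diag S1 S2) \<and> spectral_norm (block_diag S1 S2) \<le> h)"
    by (auto simp: invertible_block_diag_iff[OF S] spectral_norm_block_diag_le_iff[OF S h])
  moreover have "mse_bound H1 \<sigma> h S1 = \<infinity> \<or> mse_bound H2 \<sigma> h S2 = \<infinity>"
    using False mse_bound_eq_top by blast
  ultimately show ?thesis
    by (auto simp: mse_bound_eq_top)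
qed

section \<open>Arbitrary lists of diagonal blocks\<close>

text \<open>Base case for lists of blocks: the empty matrix is its own inverse, and all sums are
  empty.\<close>

lemma mse_bound_empty:
  assumes "0 \<le> h"
  shows "mse_bound H \<sigma> h (0\<^sub>m 0 0) = 0"
proof -
  have "spectral_norm (0\<^sub>m 0 0) \<le> h"
    using assms by (subst spectral_norm_le_iff[of _ 0 0]) (auto simp: scalar_prod_def)
  then have "mse_bound H \<sigma> h (0\<^sub>m 0 0) = ennreal (mse_value H \<sigma> (0\<^sub>m 0 0) (0\<^sub>m 0 0))"
    by (intro mse_bound_eq_mse_value[of _ 0]) auto
  then show ?thesis
    by (simp add: mse_value_def scalar_prod_def)
qed

lemma diag_block_mat_carrier:
  assumes "\<And>i. i \<in> set is \<Longrightarrow> A i \<in> carrier_mat (n i) (n i)"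
  shows "diag_block_mat (map A is) \<in> carrier_mat (\<Sum>i\<leftarrow>is. n i) (\<Sum>i\<leftarrow>is. n i)"
  using assms by (induction "is") (auto simp: diag_block_mat_Cons simp del: diag_block_mat.simps(2))

lemma mse_bound_diag_block_mat:
  assumes "\<And>i. i \<in> set is \<Longrightarrow> H i \<in> carrier_mat (n i) (n i)"
    and "\<And>i. i \<in> set is \<Longrightarrow> S i \<in> carrier_mat (n i) (n i)" and h: "0 \<le> h"
  shows "mse_bound (diag_block_mat (map H is)) \<sigma> h (diag_block_mat (map S is)) =
    (\<Sum>i\<leftarrow>is. mse_bound (H i) \<sigma> h (S i))"
  using assms(1,2)
proof (induction "is")
  case Nil
  then show ?case
    by (simp add: mse_bound_empty[OF h])
next
  case (Cons i "is")
  have "mse_bound (block_diag (H i) (diag_block_mat (map H is))) \<sigma> h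
      (block_diag (S i) (diag_block_mat (map S is))) =
      mse_bound (H i) \<sigma> h (S i) + mse_bound (diag_block_mat (map H is)) \<sigma> h (diag_block_mat (map S is))"
    using Cons.prems h by (intro mse_bound_block_diag[of _ "n i" _ "\<Sum>i\<leftarrow>is. n i"] diag_block_mat_carrier) auto
  then show ?case
    using Cons by (simp add: diag_block_mat_Cons del: diag_block_mat.simps(2))
qed

section \<open>Orthogonal change of basis\<close>

context
  fixes P :: "real mat" and d :: nat
  assumes P: "P \<in> carrier_mat d d" and orth: "P\<^sup>T * P = 1\<^sub>m d"
begin

lemma orthogonal_mult_scalar_prod:
  assumes v: "v \<in> carrier_vec d" and w: "w \<in> carrier_vec d"
  shows "(P *\<^sub>v v) \<bullet> (P *\<^sub>v w) = v \<bullet> w"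
proof -
  have "(P *\<^sub>v v) \<bullet> (P *\<^sub>v w) = (P\<^sup>T *\<^sub>v (P *\<^sub>v v)) \<bullet> w"
    using P v w by (simp add: transpose_vec_mult_scalar[OF P w])
  also have "P\<^sup>T *\<^sub>v (P *\<^sub>v v) = (P\<^sup>T * P) *\<^sub>v v"
    using P v by (intro assoc_mult_mat_vec[symmetric]) auto
  finally show ?thesis
    using v by (simp add: orth)
qed

lemma spectral_norm_orthogonal_mult_le_iff:
  assumes M: "M \<in> carrier_mat d d" and h: "0 \<le> h"
  shows "spectral_norm (P * M) \<le> h \<longleftrightarrow> spectral_norm M \<le> h"
proof -
  have "((P * M) *\<^sub>v v) \<bullet> ((P * M) *\<^sub>v v) = (M *\<^sub>v v) \<bullet> (M *\<^sub>v v)" if "v \<in> carrier_vec d" for v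
    using P M that by (simp add: assoc_mult_mat_vec[OF P M that] orthogonal_mult_scalar_prod)
  then show ?thesis
    using P M by (simp add: spectral_norm_le_iff[OF _ h, of _ d d])
qed

lemma invertible_orthogonal_mult_iff:
  assumes M: "M \<in> carrier_mat d d"
  shows "invertible_mat (P * M) \<longleftrightarrow> invertible_mat M"
proof -
  have "det (P\<^sup>T) * det P = 1"
    using det_mult[of "P\<^sup>T" d P] P orth by simp
  then have "det P \<noteq> 0"
    by auto
  then show ?thesis
    using P M det_mult[OF P M] by (simp add: invertible_mat_iff_det[of _ d])
qed

text \<open>\<open>P\<close> moves to the other factor as its transpose; commuting the scalar
  product puts \<open>P *\<^sub>v col M i\<close> on the side where that rule applies.\<close>

lemma quad_diag_mult:
  assumes M: "M \<in> carrier_mat d d" and H: "H \<in> carrier_mat d d"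
  shows "quad_diag H (P * M) = quad_diag (P\<^sup>T * H * P) M"
proof (rule eq_vecI)
  fix i assume "i < dim_vec (quad_diag (P\<^sup>T * H * P) M)"
  then have i: "i < d"
    using M by (simp add: quad_diag_def)
  let ?v = "col M i"
  have v: "?v \<in> carrier_vec d"
    using M by auto
  have "(P *\<^sub>v ?v) \<bullet> (H *\<^sub>v (P *\<^sub>v ?v)) = (H *\<^sub>v (P *\<^sub>v ?v)) \<bullet> (P *\<^sub>v ?v)"
    using P H v by (intro comm_scalar_prod[of _ d]) auto
  also have "\<dots> = (P\<^sup>T *\<^sub>v (H *\<^sub>v (P *\<^sub>v ?v))) \<bullet> ?v"
    using P H v by (intro transpose_vec_mult_scalar[OF P v, symmetric]) auto
  also have "\<dots> = ?v \<bullet> (P\<^sup>T *\<^sub>v (H *\<^sub>v (P *\<^sub>v ?v)))"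
    using P H v by (intro comm_scalar_prod[of _ d]) auto
  also have "P\<^sup>T *\<^sub>v (H *\<^sub>v (P *\<^sub>v ?v)) = (P\<^sup>T * H * P) *\<^sub>v ?v"
    using P H v by (simp add: assoc_mult_mat_vec[of _ d d _ d])
  finally show "quad_diag H (P * M) $ i = quad_diag (P\<^sup>T * H * P) M $ i"
    using P M i by (simp add: quad_diag_def col_mult2[OF P M])
qed (use M in \<open>simp add: quad_diag_def\<close>)

text \<open>If \<open>X\<close> inverts \<open>M\<close>, then \<open>X * P\<^sup>T\<close> inverts
  \<open>P * M\<close>. Its transpose is \<open>P * X\<^sup>T\<close> and its rows are images of
  rows of \<open>X\<close> under \<open>P\<close>, so the isometry \<open>P\<close> drops out of
  every norm.\<close>

lemma mse_value_orthogonal_mult: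
  assumes M: "M \<in> carrier_mat d d" and H: "H \<in> carrier_mat d d" and X: "X \<in> carrier_mat d d"
  shows "mse_value H \<sigma> (P * M) (X * P\<^sup>T) = mse_value (P\<^sup>T * H * P) \<sigma> M X"
proof -
  have "(X * P\<^sup>T)\<^sup>T = P * X\<^sup>T"
    using P X by (simp add: transpose_mult[of X d d])
  then have norm: "((X * P\<^sup>T)\<^sup>T *\<^sub>v v) \<bullet> ((X * P\<^sup>T)\<^sup>T *\<^sub>v v) = (X\<^sup>T *\<^sub>v v) \<bullet> (X\<^sup>T *\<^sub>v v)"
    if "v \<in> carrier_vec d" for v
    using P X that by (simp add: assoc_mult_mat_vec[of _ d d _ d] orthogonal_mult_scalar_prod)
  have "row (X * P\<^sup>T) i = P *\<^sub>v row X i" if "i < d" for i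
  proof (rule eq_vecI)
    fix j assume "j < dim_vec (P *\<^sub>v row X i)"
    then show "row (X * P\<^sup>T) i $ j = (P *\<^sub>v row X i) $ j"
      using P X that by (auto intro: comm_scalar_prod[of _ d])
  qed (use P in simp)
  then have "row (X * P\<^sup>T) i \<bullet> row (X * P\<^sup>T) i = row X i \<bullet> row X i" if "i < d" for i
    using X that by (simp add: orthogonal_mult_scalar_prod)
  then have rows: "(\<Sum>i<d. row (X * P\<^sup>T) i \<bullet> row (X * P\<^sup>T) i) = (\<Sum>i<d. row X i \<bullet> row X i)"
    by simp
  have dim: "dim_row (X * P\<^sup>T) = d" "dim_row X = d" "dim_col (P * M) = d" "dim_col M = d"
    using X M by auto
  show ?thesis
    unfolding mse_value_def dim rows quad_diag_mult[OF M H]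
    by (subst (1 2) norm) (use M in auto)
qed

lemma mse_bound_orthogonal_mult:
  assumes M: "M \<in> carrier_mat d d" and H: "H \<in> carrier_mat d d" and h: "0 \<le> h"
  shows "mse_bound H \<sigma> h (P * M) = mse_bound (P\<^sup>T * H * P) \<sigma> h M"
proof (cases "invertible_mat M \<and> spectral_norm M \<le> h")
  case True
  then obtain X where X: "X \<in> carrier_mat d d" and MX: "M * X = 1\<^sub>m d"
    using M by (auto simp: invertible_mat_iff_right_inverse)
  have PT: "P\<^sup>T \<in> carrier_mat d d"
    using P by simp
  have "(P * M) * (X * P\<^sup>T) = P * (M * X) * P\<^sup>T"
    using P PT M X by (simp add: assoc_mult_mat[of _ d d _ d _ d])
  \<comment> \<open>For square matrices \<open>orth\<close> also yields
    \<open>P * P\<^sup>T = 1\<^sub>m d\<close>.\<close>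
  also have "\<dots> = 1\<^sub>m d"
    using mat_mult_left_right_inverse[OF PT P orth] P by (simp add: MX)
  finally have "mse_bound H \<sigma> h (P * M) = ennreal (mse_value H \<sigma> (P * M) (X * P\<^sup>T))"
    using True P M X spectral_norm_orthogonal_mult_le_iff[OF M h]
    by (intro mse_bound_eq_mse_value[of _ d]) auto
  also have "\<dots> = mse_bound (P\<^sup>T * H * P) \<sigma> h M"
    using True mse_bound_eq_mse_value[OF M X MX] by (simp add: mse_value_orthogonal_mult[OF M H X])
  finally show ?thesis .
next
  case False
  then show ?thesis
    by (simp add: mse_bound_eq_top invertible_orthogonal_mult_iff[OF M]
        spectral_norm_orthogonal_mult_le_iff[OF M h])
qed

end

section \<open>Gram matrices of lists of vectors\<close>

text \<open>The matrix of the bilinear form of \<open>D\<close> on a list of vectors. With lists,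
  joining matrices side by side is appending.\<close>

definition gram_mat :: "real mat \<Rightarrow> real vec list \<Rightarrow> real mat" where
  "gram_mat D xs = mat (length xs) (length xs) (\<lambda>(a, b). xs ! a \<bullet> (D *\<^sub>v xs ! b))"

text \<open>Serves for the identity (orthogonality of the basis matrix), for \<open>D\<close> on the
  whole basis, and for \<open>D\<close> on each cell.\<close>

lemma transpose_mult_mult_mat_of_cols:
  assumes D: "D \<in> carrier_mat d d" and xs: "set xs \<subseteq> carrier_vec d"
  shows "(mat_of_cols d xs)\<^sup>T * D * mat_of_cols d xs = gram_mat D xs"
proof -
  let ?M = "mat_of_cols d xs"
  have M: "?M \<in> carrier_mat d (length xs)"
    by simp
  have "?M\<^sup>T * D * ?M = ?M\<^sup>T * (D * ?M)"
    using D M by (intro assoc_mult_mat[of _ "length xs" d _ d]) auto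
  also have "\<dots> = gram_mat D xs"
  proof (rule eq_matI)
    fix a b assume "a < dim_row (gram_mat D xs)" "b < dim_col (gram_mat D xs)"
    then have ab: "a < length xs" "b < length xs"
      by (auto simp: gram_mat_def)
    then have "xs ! a \<in> carrier_vec d" "xs ! b \<in> carrier_vec d"
      using xs by auto
    then show "(?M\<^sup>T * (D * ?M)) $$ (a, b) = gram_mat D xs $$ (a, b)"
      using ab D by (simp add: gram_mat_def col_mult2[OF D M])
  qed (auto simp: gram_mat_def)
  finally show ?thesis .
qed

text \<open>Each of the two orders makes one off-diagonal block of a Gram matrix vanish.\<close>

definition bilinear_orthogonal :: "real mat \<Rightarrow> real vec set \<Rightarrow> real vec set \<Rightarrow> bool" where
  "bilinear_orthogonal D X Y \<longleftrightarrow> (\<forall>x\<in>X. \<forall>y\<in>Y. x \<bullet> (D *\<^sub>v y) = 0 \<and> y \<bullet> (D *\<^sub>v x) = 0)"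

lemma gram_mat_append:
  assumes "bilinear_orthogonal D (set xs) (set ys)"
  shows "gram_mat D (xs @ ys) = block_diag (gram_mat D xs) (gram_mat D ys)"
  using assms
  by (intro eq_matI) (auto simp: gram_mat_def block_diag_def bilinear_orthogonal_def nth_append)

text \<open>\<open>sorted_wrt\<close> relates each list to all later ones, which is what splitting
  off the head requires.\<close>

lemma gram_mat_concat:
  assumes "sorted_wrt (\<lambda>xs ys. bilinear_orthogonal D (set xs) (set ys)) xss"
  shows "gram_mat D (concat xss) = diag_block_mat (map (gram_mat D) xss)"
  using assms
proof (induction xss)
  case Nil
  then show ?case
    by (auto simp: gram_mat_def)
next
  case (Cons xs xss)
  then have "bilinear_orthogonal D (set xs) (set (concat xss))"
    by (auto simp: bilinear_orthogonal_def)
  then show ?case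
    using Cons by (simp add: gram_mat_append diag_block_mat_Cons del: diag_block_mat.simps(2))
qed

text \<open>For unit vectors the form picks out a single entry of \<open>D\<close>, here off the
  diagonal.\<close>

lemma unit_vecs_diagonal_orthogonal:
  fixes D :: "real mat"
  assumes D: "D \<in> carrier_mat d d" "diagonal_mat D"
    and "x \<in> set (unit_vecs d)" "y \<in> set (unit_vecs d)" "x \<noteq> y"
  shows "x \<bullet> (D *\<^sub>v y) = 0"
proof -
  obtain p q where pq: "x = unit_vec d p" "y = unit_vec d q" "p < d" "q < d" "p \<noteq> q"
    using assms(3-5) by (auto simp: unit_vecs_def)
  then show ?thesis
    using D by (simp add: scalar_prod_left_unit[of _ d] scalar_prod_right_unit diagonal_mat_def)
qed

lemma gram_mat_one_unit_vecs:
  assumes "distinct xs" "set xs \<subseteq> set (unit_vecs d)"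
  shows "gram_mat (1\<^sub>m d) xs = 1\<^sub>m (length xs)"
proof (rule eq_matI)
  fix a b assume "a < dim_row (1\<^sub>m (length xs))" "b < dim_col (1\<^sub>m (length xs))"
  then have ab: "a < length xs" "b < length xs"
    by auto
  then have xs: "xs ! a \<in> set (unit_vecs d)" "xs ! b \<in> set (unit_vecs d)"
    using assms(2) by auto
  show "gram_mat (1\<^sub>m d) xs $$ (a, b) = 1\<^sub>m (length xs) $$ (a, b)"
  proof (cases "a = b")
    case True
    then show ?thesis
      using ab xs by (auto simp: gram_mat_def unit_vecs_def)
  next
    case False
    \<comment> \<open>The identity is itself diagonal, and distinctness of \<open>xs\<close> makes
      the two vectors differ.\<close>
    then have "xs ! a \<bullet> (1\<^sub>m d *\<^sub>v xs ! b) = 0"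
      using ab xs assms(1)
      by (intro unit_vecs_diagonal_orthogonal) (auto simp: diagonal_mat_def nth_eq_iff_index_eq)
    then show ?thesis
      using ab False by (simp add: gram_mat_def)
  qed
qed (auto simp: gram_mat_def)

section \<open>Decomposition of \<open>l\<close> along a partition of the standard basis\<close>

theorem proposition16:
  fixes \<sigma> h :: real
    and d k :: nat
    and D :: "real mat"
    and cell :: "nat \<Rightarrow> real vec set"
    and n :: "nat \<Rightarrow> nat"
    and B S :: "nat \<Rightarrow> real mat"
  assumes "\<sigma> > 0" and "h > 0"
    and "D \<in> carrier_mat d d" and "diagonal_mat D"
    and "mat_trace D > 0" and "sorted (diag_mat D)"
    and "partition_on (set (unit_vecs d)) (cell ` {..<k})" and "inj_on cell {..<k}"
    and "\<And>i. i < k \<Longrightarrow> n i = card (cell i)"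
    and "\<And>i. i < k \<Longrightarrow> B i \<in> carrier_mat d (n i)"
    and "\<And>i. i < k \<Longrightarrow> set (cols (B i)) = cell i"
    and "\<And>i. i < k \<Longrightarrow> S i \<in> carrier_mat (n i) (n i)"
  shows "mse_bound D \<sigma> h (concat_cols d (map B [0..<k]) * diag_block_mat (map S [0..<k]))
       = (\<Sum>i<k. mse_bound (transpose_mat (B i) * D * B i) \<sigma> h (S i))"
proof -
  note D = assms(3) and n = assms(9) and B = assms(10) and cell = assms(11) and S = assms(12)
  let ?xss = "map (\<lambda>i. cols (B i)) [0..<k]"
  let ?P = "concat_cols d (map B [0..<k])"
  let ?M = "diag_block_mat (map S [0..<k])"
  have h: "0 \<le> h"
    using assms(2) by simp
  have union: "(\<Union>i<k. cell i) = set (unit_vecs d)"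
    using assms(7) by (simp add: partition_on_def)
  then have sub: "cell i \<subseteq> set (unit_vecs d)" if "i < k" for i
    using that by blast
  have disj: "cell i \<inter> cell j = {}" if "i < k" "j < k" "i \<noteq> j" for i j
  proof -
    \<comment> \<open>The partition is a set of cells, so injectivity of \<open>cell\<close> is what
      separates different indices.\<close>
    have "cell i \<noteq> cell j"
      using assms(8) that by (auto simp: inj_on_eq_iff)
    moreover have "disjoint (cell ` {..<k})"
      using assms(7) by (simp add: partition_on_def)
    ultimately show ?thesis
      using that by (auto dest: disjointD)
  qed
  have card_unit: "card (set (unit_vecs d :: real vec list)) = d"
    by (simp add: unit_vecs_def card_image inj_on_def)
  have sum_n: "(\<Sum>i\<leftarrow>[0..<k]. n i) = d"
  proof -
    have "(\<Sum>i\<leftarrow>[0..<k]. n i) = (\<Sum>i<k. card (cell i))"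
      using n by (simp add: interv_sum_list_conv_sum_set_nat atLeast0LessThan)
    also have "\<dots> = card (\<Union>i<k. cell i)"
      using disj finite_subset[OF sub finite_set] by (intro card_UN_disjoint[symmetric]) auto
    finally show ?thesis
      by (simp add: union card_unit)
  qed
  have set_xss: "set (concat ?xss) = set (unit_vecs d)"
    by (simp add: cell atLeast0LessThan union)
  have length_xss: "length (concat ?xss) = d"
  proof -
    have "map (\<lambda>i. length (cols (B i))) [0..<k] = map n [0..<k]"
      using carrier_matD(2)[OF B] by simp
    then have "(\<Sum>i\<leftarrow>[0..<k]. length (cols (B i))) = d"
      by (simp only: sum_n)
    then show ?thesis
      by (simp add: length_concat comp_def)
  qed
  \<comment> \<open>Each \<open>B i\<close> is given only through the set of its columns.
    Repetitions are excluded by counting: the joined list has \<open>d\<close> entries and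
    \<open>d\<close> distinct values.\<close>
  have distinct: "distinct (concat ?xss)"
    by (rule card_distinct) (simp only: set_xss card_unit length_xss)
  have unit_carrier: "set (concat ?xss) \<subseteq> carrier_vec d"
    unfolding set_xss by (rule unit_vecs_carrier)
  have P_eq: "?P = mat_of_cols d (concat ?xss)"
    by (simp add: concat_cols_def comp_def)
  have P: "?P \<in> carrier_mat d d"
    unfolding P_eq using mat_of_cols_carrier(1)[of d "concat ?xss"] by (simp only: length_xss)
  \<comment> \<open>Inserting the identity matrix turns orthogonality of \<open>?P\<close> into a
    statement about a Gram matrix.\<close>
  have "?P\<^sup>T * ?P = ?P\<^sup>T * 1\<^sub>m d * ?P"
    using P by simp
  also have "\<dots> = gram_mat (1\<^sub>m d) (concat ?xss)"
    unfolding P_eq by (rule transpose_mult_mult_mat_of_cols[OF one_carrier_mat unit_carrier])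
  also have "\<dots> = 1\<^sub>m d"
    using gram_mat_one_unit_vecs[OF distinct, of d] by (simp only: set_xss length_xss order_refl)
  finally have orth: "?P\<^sup>T * ?P = 1\<^sub>m d" .
  have "?P\<^sup>T * D * ?P = gram_mat D (concat ?xss)"
    unfolding P_eq by (rule transpose_mult_mult_mat_of_cols[OF D unit_carrier])
  also have "\<dots> = diag_block_mat (map (gram_mat D) ?xss)"
  proof (rule gram_mat_concat)
    \<comment> \<open>Vectors from different cells are different unit vectors, and \<open>D\<close>
      is diagonal.\<close>
    have "bilinear_orthogonal D (cell i) (cell j)" if "i < k" "j < k" "i \<noteq> j" for i j
      using disj[OF that] sub[OF that(1)] sub[OF that(2)]
      unfolding bilinear_orthogonal_def
      by (auto intro!: unit_vecs_diagonal_orthogonal[OF D assms(4)])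
    then show "sorted_wrt (\<lambda>xs ys. bilinear_orthogonal D (set xs) (set ys)) ?xss"
      using cell by (simp add: sorted_wrt_iff_nth_less)
  qed
  also have "map (gram_mat D) ?xss = map (\<lambda>i. (B i)\<^sup>T * D * B i) [0..<k]"
  proof -
    have "gram_mat D (cols (B i)) = (B i)\<^sup>T * D * B i" if "i < k" for i
    proof -
      have "mat_of_cols d (cols (B i)) = B i"
        using B[OF that] mat_of_cols_cols[of "B i"] by simp
      then show ?thesis
        using transpose_mult_mult_mat_of_cols[OF D, of "cols (B i)"] B[OF that] cols_dim[of "B i"]
        by simp
    qed
    then show ?thesis
      by simp
  qed
  finally have PDP: "?P\<^sup>T * D * ?P = diag_block_mat (map (\<lambda>i. (B i)\<^sup>T * D * B i) [0..<k])" .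
  have M: "?M \<in> carrier_mat d d"
    using diag_block_mat_carrier[of "[0..<k]" S n] S by (simp add: sum_n)
  have "mse_bound D \<sigma> h (?P * ?M) =
      mse_bound (diag_block_mat (map (\<lambda>i. (B i)\<^sup>T * D * B i) [0..<k])) \<sigma> h ?M"
    using mse_bound_orthogonal_mult[OF P orth M D h] by (simp only: PDP)
  also have "\<dots> = (\<Sum>i\<leftarrow>[0..<k]. mse_bound ((B i)\<^sup>T * D * B i) \<sigma> h (S i))"
  proof (rule mse_bound_diag_block_mat[OF _ _ h])
    fix i assume "i \<in> set [0..<k]"
    then have "i < k"
      by simp
    then show "S i \<in> carrier_mat (n i) (n i)" "(B i)\<^sup>T * D * B i \<in> carrier_mat (n i) (n i)"
      using S[of i] B[of i] D by auto
  qed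
  also have "\<dots> = (\<Sum>i<k. mse_bound ((B i)\<^sup>T * D * B i) \<sigma> h (S i))"
    by (simp add: interv_sum_list_conv_sum_set_nat atLeast0LessThan)
  finally show ?thesis .
qed

end
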